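(* Every connected block graph $H$ is (isomorphic to) the reduced clique graph $C_r(G)$ of some $k$-tree $G$, for some integer $k\ge 1$.
   Context: A block graph is a graph in which every block (maximal 2-connected subgraph, or bridge) is a complete graph. A $k$-tree: $K_{k+1}$ is a $k$-tree, and adding to a $k$-tree a new vertex adjacent exactly to the vertices of a $k$-clique gives a $k$-tree. For a chordal graph $G$, maximal cliques $Q,Q'$ form a separating pair if $Q\cap Q'\ne\emptyset$ and every path in $G$ from $Q\setminus Q'$ to $Q'\setminus Q$ contains a vertex of $Q\cap Q'$; the reduced clique graph $C_r(G)$ has the maximal cliques of $G$ as vertices, two adjacent iff they form a separating pair. *)

theory Defs
  imports
    "Graph_Theory.Digraph_Component"
    "Graph_Theory.Digraph_Isomorphism"
    "Graph_Theory.Vertex_Walk"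
    "Graph_Theory.Kuratowski"
begin

text \<open>
  Finite simple undirected graphs are symmetric loop-free finite digraphs
  (\<^locale>\<open>graph\<close>, \<^locale>\<open>pair_graph\<close>); an edge is a pair of opposite arcs.
\<close>

subsection \<open>Block graphs\<close>

text \<open>
  The conjunct \<^prop>\<open>graph B\<close> matters when 2-connected subgraphs are considered:
  \<^const>\<open>subgraph\<close> alone would also admit subdigraphs that contain only one of the two
  arcs of an edge.
\<close>

definition two_connected :: "('a, 'b) pre_digraph \<Rightarrow> bool" where
  "two_connected B \<longleftrightarrow> graph B \<and> 3 \<le> card (verts B) \<and> Digraph_Component.connected B \<and>
     (\<forall>v \<in> verts B. Digraph_Component.connected (pre_digraph.del_vert B v))"

definition delete_edge :: "'a pair_pre_digraph \<Rightarrow> 'a \<Rightarrow> 'a \<Rightarrow> 'a pair_pre_digraph" where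
  "delete_edge G u v = \<lparr> pverts = pverts G, parcs = parcs G - {(u, v), (v, u)} \<rparr>"

definition bridge :: "'a pair_pre_digraph \<Rightarrow> 'a \<Rightarrow> 'a \<Rightarrow> bool" where
  "bridge G u v \<longleftrightarrow> (u, v) \<in> parcs G \<and> \<not> u \<rightarrow>\<^sup>*\<^bsub>with_proj (delete_edge G u v)\<^esub> v"

definition edge_graph :: "'a \<Rightarrow> 'a \<Rightarrow> 'a pair_pre_digraph" where
  "edge_graph u v = \<lparr> pverts = {u, v}, parcs = {(u, v), (v, u)} \<rparr>"

definition block :: "'a pair_pre_digraph \<Rightarrow> ('a, 'a \<times> 'a) pre_digraph \<Rightarrow> bool" where
  "block G B \<longleftrightarrow> pre_digraph.max_subgraph (with_proj G) two_connected B \<or>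
     (\<exists>u v. bridge G u v \<and> B = with_proj (edge_graph u v))"

definition block_graph :: "'a pair_pre_digraph \<Rightarrow> bool" where
  "block_graph G \<longleftrightarrow> pair_graph G \<and> (\<forall>B. block G B \<longrightarrow> complete_digraph (card (verts B)) B)"

subsection \<open>\<open>k\<close>-trees\<close>

definition clique :: "'a pair_pre_digraph \<Rightarrow> 'a set \<Rightarrow> bool" where
  "clique G C \<longleftrightarrow> C \<subseteq> pverts G \<and> (\<forall>u \<in> C. \<forall>v \<in> C. u \<noteq> v \<longrightarrow> (u, v) \<in> parcs G)"

definition attach_vertex :: "'a pair_pre_digraph \<Rightarrow> 'a \<Rightarrow> 'a set \<Rightarrow> 'a pair_pre_digraph" where
  "attach_vertex G v C =
     \<lparr> pverts = insert v (pverts G), parcs = parcs G \<union> {v} \<times> C \<union> C \<times> {v} \<rparr>"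

inductive k_tree :: "nat \<Rightarrow> 'a pair_pre_digraph \<Rightarrow> bool" for k :: nat where
  complete: "complete_digraph (k + 1) (with_proj G) \<Longrightarrow> k_tree k G"
| attach: "k_tree k G \<Longrightarrow> v \<notin> pverts G \<Longrightarrow> clique G C \<Longrightarrow> finite C \<Longrightarrow> card C = k \<Longrightarrow>
    k_tree k (attach_vertex G v C)"

subsection \<open>Reduced clique graphs\<close>

definition max_clique :: "'a pair_pre_digraph \<Rightarrow> 'a set \<Rightarrow> bool" where
  "max_clique G Q \<longleftrightarrow> clique G Q \<and> (\<forall>Q'. clique G Q' \<and> Q \<subseteq> Q' \<longrightarrow> Q' = Q)"

definition separating_pair :: "'a pair_pre_digraph \<Rightarrow> 'a set \<Rightarrow> 'a set \<Rightarrow> bool" where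
  "separating_pair G Q Q' \<longleftrightarrow> Q \<inter> Q' \<noteq> {} \<and>
     (\<forall>p. vpath p (with_proj G) \<and> hd p \<in> Q - Q' \<and> last p \<in> Q' - Q \<longrightarrow>
        set p \<inter> (Q \<inter> Q') \<noteq> {})"

text \<open>
  \<^term>\<open>separating_pair G Q Q\<close> holds vacuously for nonempty \<open>Q\<close>; the condition
  \<^prop>\<open>Q \<noteq> Q'\<close> keeps the reduced clique graph free of loops.
\<close>

definition reduced_clique_graph :: "'a pair_pre_digraph \<Rightarrow> 'a set pair_pre_digraph" where
  "reduced_clique_graph G =
     \<lparr> pverts = {Q. max_clique G Q},
       parcs = {(Q, Q'). max_clique G Q \<and> max_clique G Q' \<and> Q \<noteq> Q' \<and> separating_pair G Q Q'} \<rparr>"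

end

theory Submission
  imports Defs
begin

text \<open>
  In a block graph every cycle spans a clique, since the subgraph it induces is 2-connected. Hence, if
  \<open>w\<close> is not a cut vertex of a connected block graph, its neighbours are pairwise adjacent, and if there
  are at least two of them, no further vertex is adjacent to two of them. Adding such vertices one
  by one, we build a \<open>k\<close>-tree with \<open>k = card V(H)\<close> whose maximal cliques \<open>Q u\<close> are indexed by the
  vertices of \<open>H\<close>, such that distinct \<open>u\<close>, \<open>v\<close> are adjacent iff \<open>Q u\<close> and \<open>Q v\<close> share \<open>k\<close> elements.
  The vertex \<open>w\<close> gets the clique \<open>S \<union> {z}\<close> with \<open>z\<close> fresh, where \<open>S\<close> is a \<open>k\<close>-set contained in \<open>Q u\<close>
  exactly for the neighbours \<open>u\<close> of \<open>w\<close>: the intersection of the cliques of two neighbours, or, for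
  a single neighbour \<open>a\<close>, a \<open>k\<close>-subset of \<open>Q a\<close> different from all \<open>Q a \<inter> Q u\<close>, which exists because
  \<open>k\<close> is large. Finally, maximal cliques of a \<open>k\<close>-tree form a separating pair iff they share \<open>k\<close>
  elements, because a \<open>k\<close>-tree cannot be disconnected by removing fewer than \<open>k\<close> vertices.
\<close>

section \<open>Connected vertex sets\<close>

text \<open>\<open>rtrancl_on U E\<close> keeps entire walks inside \<open>U\<close>, so deleting
  vertices amounts to shrinking \<open>U\<close> while \<open>E\<close> stays fixed. The empty set
  counts as connected.\<close>

definition connected_on :: "('a \<times> 'a) set \<Rightarrow> 'a set \<Rightarrow> bool" where
  "connected_on E U \<longleftrightarrow> (\<forall>x \<in> U. \<forall>y \<in> U. (x, y) \<in> rtrancl_on U E)"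

abbreviation walk_in :: "('a \<times> 'a) set \<Rightarrow> 'a list \<Rightarrow> bool" where
  "walk_in E p \<equiv> successively (\<lambda>x y. (x, y) \<in> E) p"

lemma connected_on_mono:
  assumes "connected_on E U" "E \<subseteq> F"
  shows "connected_on F U"
  using assms rtrancl_on_mono[of E F U U] unfolding connected_on_def by blast

lemma connected_on_insert:
  assumes "connected_on E U" "sym E" "u \<in> U" "(u, x) \<in> E"
  shows "connected_on E (insert x U)"
proof -
  have U: "(a, b) \<in> rtrancl_on (insert x U) E" if "a \<in> U" "b \<in> U" for a b
    using assms(1) that rtrancl_on_mono[of E E U "insert x U"] unfolding connected_on_def by blast
  have xu: "(x, u) \<in> E"
    using assms(2,4) by (auto dest: symD)
  have "(a, x) \<in> rtrancl_on (insert x U) E" if "a \<in> U" for a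
    using U[OF that assms(3)] assms(4) by (rule rtrancl_on_into_rtrancl_on) simp
  moreover have "(x, a) \<in> rtrancl_on (insert x U) E" if "a \<in> U" for a
    using xu U[OF assms(3) that] by (rule converse_rtrancl_on_into_rtrancl_on) simp
  ultimately show ?thesis
    using U unfolding connected_on_def by auto
qed

lemma walk_in_imp_connected_on:
  assumes "sym E" "walk_in E p"
  shows "connected_on E (set p)"
  using assms(2)
proof (induction p)
  case Nil
  then show ?case by (simp add: connected_on_def)
next
  case (Cons x p)
  show ?case
  proof (cases "p = []")
    case True
    then show ?thesis by (auto simp: connected_on_def)
  next
    case False
    with Cons have "connected_on E (set p)" "(hd p, x) \<in> E"
      using assms(1) by (auto simp: successively_Cons dest: symD)
    with connected_on_insert[OF _ assms(1), of "set p" "hd p" x] False show ?thesis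
      by simp
  qed
qed

lemma rtrancl_on_imp_path:
  assumes "(x, y) \<in> rtrancl_on U E"
  shows "\<exists>p. p \<noteq> [] \<and> distinct p \<and> set p \<subseteq> U \<and> walk_in E p \<and> hd p = x \<and> last p = y"
  using assms
proof (induction rule: rtrancl_on_induct)
  case base
  then show ?case by (intro exI[of _ "[x]"]) auto
next
  case (step y z)
  then obtain p where p: "p \<noteq> []" "distinct p" "set p \<subseteq> U" "walk_in E p" "hd p = x" "last p = y"
    by blast
  show ?case
  proof (cases "z \<in> set p")
    \<comment> \<open>If \<open>z\<close> already lies on the path, the path is cut at
      \<open>z\<close>, which keeps it distinct.\<close>
    case True
    then obtain xs ys where "p = xs @ z # ys"
      by (meson split_list)
    with p show ?thesis
      by (intro exI[of _ "xs @ [z]"]) (auto simp: successively_append_iff hd_append split: if_splits)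
  next
    case False
    with p step show ?thesis
      by (intro exI[of _ "p @ [z]"]) (auto simp: successively_append_iff)
  qed
qed

lemma connected_on_leaves:
  assumes "connected_on E V" "U \<subset> V" "U \<noteq> {}"
  shows "\<exists>u \<in> U. \<exists>x \<in> V - U. (u, x) \<in> E"
proof (rule ccontr)
  assume *: "\<not> ?thesis"
  obtain a b where "a \<in> U" "b \<in> V - U"
    using assms by blast
  then have "(a, b) \<in> rtrancl_on V E"
    using assms unfolding connected_on_def by blast
  then have "b \<in> U"
    by (induction rule: rtrancl_on_induct) (use * \<open>a \<in> U\<close> in auto)
  with \<open>b \<in> V - U\<close> show False by blast
qed

text \<open>A largest nonempty connected proper subset \<open>U\<close> of \<open>V\<close> omits
  just one vertex: otherwise an edge leaving \<open>U\<close> would extend it to a larger such set.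
  The omitted vertex is not a cut vertex.\<close>

lemma ex_noncut_vertex:
  assumes "sym E" "finite V" "connected_on E V" "2 \<le> card V"
  shows "\<exists>w \<in> V. connected_on E (V - {w})"
proof -
  obtain r where r: "r \<in> V"
    using assms(4) by fastforce
  define P where "P = (\<lambda>U. U \<subset> V \<and> U \<noteq> {} \<and> connected_on E U)"
  have "V \<noteq> {r}"
    using assms(4) by auto
  with r have "P {r}"
    by (auto simp: P_def connected_on_def)
  moreover have "\<forall>U. P U \<longrightarrow> card U < Suc (card V)"
    using assms(2) by (auto simp: P_def less_Suc_eq_le intro: card_mono)
  ultimately obtain U where U: "P U" and max: "\<And>U'. P U' \<Longrightarrow> card U' \<le> card U"
    using ex_has_greatest_nat[of P "{r}" card "Suc (card V)"] by metis
  then obtain u x where ux: "u \<in> U" "x \<in> V - U" "(u, x) \<in> E"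
    using connected_on_leaves[OF assms(3), of U] unfolding P_def by blast
  have "finite U"
    using U assms(2) finite_subset unfolding P_def by blast
  with ux have "\<not> P (insert x U)"
    using max[of "insert x U"] by auto
  moreover have "connected_on E (insert x U)"
    using U connected_on_insert[OF _ assms(1) ux(1,3)] unfolding P_def by simp
  ultimately have "insert x U = V"
    using U ux unfolding P_def by blast
  with ux have "V - {x} = U" by auto
  with U ux show ?thesis
    unfolding P_def by auto
qed

section \<open>Block graphs\<close>

text \<open>A cycle is a vertex \<open>w\<close>, a path \<open>p\<close> and a closing edge from
  \<open>last p\<close> to \<open>w\<close>, with \<open>2 \<le> length p\<close> forcing at least
  three vertices. This form suits closing a path through a deleted vertex.\<close>

definition cycles_complete :: "('a \<times> 'a) set \<Rightarrow> 'a set \<Rightarrow> bool" where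
  "cycles_complete E V \<longleftrightarrow> (\<forall>w p. distinct (w # p) \<and> set (w # p) \<subseteq> V \<and> 2 \<le> length p \<and>
     walk_in E (w # p) \<and> (last p, w) \<in> E \<longrightarrow>
     (\<forall>x \<in> set (w # p). \<forall>y \<in> set (w # p). x \<noteq> y \<longrightarrow> (x, y) \<in> E))"

lemma cycles_complete_subset: "cycles_complete E V \<Longrightarrow> U \<subseteq> V \<Longrightarrow> cycles_complete E U"
  unfolding cycles_complete_def by (meson order_trans)

lemma cycle_minus_vertex_connected_on:
  assumes "sym E" "distinct (w # p)" "walk_in E (w # p)" "p \<noteq> []" "(last p, w) \<in> E"
    and "v \<in> set (w # p)"
  shows "connected_on E (set (w # p) - {v})"
proof (cases "v = w")
  case True
  with assms have "set (w # p) - {v} = set p" by auto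
  then show ?thesis
    using assms walk_in_imp_connected_on[of E p] by (simp add: successively_Cons)
next
  case False
  then obtain xs ys where p: "p = xs @ v # ys"
    using assms(6) by (auto simp: in_set_conv_decomp)
  \<comment> \<open>The cycle is cut open at \<open>v\<close>; the closing edge joins a nonempty
    \<open>ys\<close> to \<open>w\<close>.\<close>
  have "walk_in E (ys @ w # xs)"
    using assms(3,5) unfolding p
    by (auto simp: successively_append_iff successively_Cons hd_append split: if_splits)
  moreover have "set (w # p) - {v} = set (ys @ w # xs)"
    using assms(2) p by auto
  ultimately show ?thesis
    using walk_in_imp_connected_on[OF assms(1)] by metis
qed

section \<open>Induced subgraphs, 2-connectedness and blocks\<close>

abbreviation induced :: "'a pair_pre_digraph \<Rightarrow> 'a set \<Rightarrow> 'a pair_pre_digraph" where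
  "induced H U \<equiv> \<lparr> pverts = U, parcs = parcs H \<inter> U \<times> U \<rparr>"

lemma rtrancl_on_Int: "rtrancl_on U (E \<inter> U \<times> U) = rtrancl_on U E"
proof -
  have "(a, b) \<in> rtrancl_on U (E \<inter> U \<times> U)" if "(a, b) \<in> rtrancl_on U E" for a b
    using that by (induction rule: rtrancl_on_induct) (auto intro: rtrancl_on_into_rtrancl_on)
  then show ?thesis
    using rtrancl_on_mono[of "E \<inter> U \<times> U" E U U] by auto
qed

lemma (in pair_graph) sym_parcs: "sym (parcs G)"
  using sym_arcs unfolding symmetric_def by simp

lemma (in pair_graph) induced_pair_graph:
  assumes "U \<subseteq> pverts G"
  shows "pair_graph (induced G U)"
proof
  show "finite (pverts (induced G U))"
    using finite_subset[OF assms finite_verts] by simp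
  show "finite (parcs (induced G U))"
    using finite_arcs by auto
  show "symmetric (with_proj (induced G U))"
    using sym_parcs unfolding symmetric_def by (auto intro!: symI dest: symD)
qed (auto dest: no_loops')

lemma (in pair_graph) connected_induced_iff:
  assumes "U \<subseteq> pverts G"
  shows "Digraph_Component.connected (with_proj (induced G U)) \<longleftrightarrow> U \<noteq> {} \<and> connected_on (parcs G) U"
proof -
  interpret I: pair_graph "induced G U"
    by (rule induced_pair_graph) fact
  \<comment> \<open>\<open>connected_conv\<close> refers to the symmetric closure of the arcs, which
    adds nothing to symmetric arcs.\<close>
  have "(parcs G \<inter> U \<times> U)\<^sup>s = parcs G \<inter> U \<times> U"
    using I.sym_parcs by (auto simp: symcl_def dest: symD)
  then show ?thesis
    using connected_conv[of "with_proj (induced G U)"] by (simp add: connected_on_def rtrancl_on_Int)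
qed

lemma (in pair_graph) connected_iff_connected_on:
  "Digraph_Component.connected (with_proj G) \<longleftrightarrow> pverts G \<noteq> {} \<and> connected_on (parcs G) (pverts G)"
proof -
  have "parcs G \<inter> pverts G \<times> pverts G = parcs G"
    using in_arcsD1 in_arcsD2 by auto
  then have "induced G (pverts G) = G" by simp
  with connected_induced_iff[of "pverts G"] show ?thesis by simp
qed

lemma (in pair_graph) induced_two_connected:
  assumes "U \<subseteq> pverts G" "3 \<le> card U" "connected_on (parcs G) U"
    and "\<And>v. v \<in> U \<Longrightarrow> connected_on (parcs G) (U - {v})"
  shows "two_connected (with_proj (induced G U))"
proof -
  interpret I: pair_graph "induced G U"
    by (rule induced_pair_graph) fact
  have "Digraph_Component.connected (pre_digraph.del_vert (with_proj (induced G U)) v)"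
    if "v \<in> U" for v
  proof -
    have "pre_digraph.del_vert (with_proj (induced G U)) v = with_proj (induced G (U - {v}))"
      by (auto simp: pre_digraph.del_vert_def with_proj_def)
    moreover have "U - {v} \<noteq> {}"
      using assms(2) card_mono[of "{v}" U] by auto
    ultimately show ?thesis
      using connected_induced_iff[of "U - {v}"] assms(1) assms(4)[OF that] by auto
  qed
  moreover have "U \<noteq> {}"
    using assms(2) by auto
  ultimately show ?thesis
    using assms I.pair_graphD_graph connected_induced_iff[OF assms(1)]
    unfolding two_connected_def by simp
qed

lemma (in pair_graph) subgraph_induced:
  assumes "U \<subseteq> pverts G"
  shows "subgraph (with_proj (induced G U)) (with_proj G)"
proof -
  interpret I: pair_graph "induced G U"
    by (rule induced_pair_graph) fact
  show ?thesis
    by (rule subgraphI) (use assms I.wf_digraph wf_digraph in auto)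
qed

text \<open>Among the subgraphs with \<open>P\<close> that contain \<open>B\<close>, one with the
  largest total number of vertices and arcs is maximal, since a proper extension would raise that
  number.\<close>

lemma (in fin_digraph) ex_max_subgraph:
  assumes "subgraph B G" "P B"
  shows "\<exists>B'. max_subgraph P B' \<and> subgraph B B'"
proof -
  define f where "f = (\<lambda>B :: ('a, 'b) pre_digraph. card (verts B) + card (arcs B))"
  define R where "R = (\<lambda>B'. subgraph B B' \<and> subgraph B' G \<and> P B')"
  have "R B"
    using assms wf_digraph.subgraph_refl unfolding R_def subgraph_def by blast
  moreover have "\<forall>B'. R B' \<longrightarrow> f B' < Suc (f G)"
    unfolding R_def f_def subgraph_def less_Suc_eq_le by (auto intro!: add_mono card_mono)
  ultimately obtain B' where B': "R B'" and max: "\<And>C. R C \<Longrightarrow> f C \<le> f B'"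
    using ex_has_greatest_nat[of R B f "Suc (f G)"] by metis
  have "C = B'" if C: "subgraph B' C" "subgraph C G" "P C" for C
  proof -
    have "R C"
      using B' C subgraph_trans unfolding R_def by blast
    then have le: "f C \<le> f B'" by (rule max)
    have fin: "finite (verts C)" "finite (arcs C)"
      using C(2) finite_verts finite_arcs finite_subset unfolding subgraph_def by blast+
    have sub: "verts B' \<subseteq> verts C" "arcs B' \<subseteq> arcs C"
      using C(1) unfolding subgraph_def by auto
    have "card (verts B') \<le> card (verts C)" "card (arcs B') \<le> card (arcs C)"
      using fin sub by (auto intro: card_mono)
    with le have "card (verts B') = card (verts C)" "card (arcs B') = card (arcs C)"
      unfolding f_def by auto
    then have "verts B' = verts C" "arcs B' = arcs C"
      using fin sub card_subset_eq by blast+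
    moreover have "tail B' = tail C" "head B' = head C"
      using C(1) unfolding subgraph_def compatible_def by auto
    ultimately show ?thesis by simp
  qed
  then show ?thesis
    using B' unfolding R_def max_subgraph_def by blast
qed

text \<open>A cycle stays connected when a vertex is removed, so its vertices induce a 2-connected
  subgraph. A maximal 2-connected subgraph above it is a block, hence complete, and its arcs belong
  to \<open>H\<close>.\<close>

lemma block_graph_imp_cycles_complete:
  assumes "block_graph H"
  shows "cycles_complete (parcs H) (pverts H)"
  unfolding cycles_complete_def
proof (intro allI impI, elim conjE)
  fix w p
  assume dist: "distinct (w # p)" and sub: "set (w # p) \<subseteq> pverts H" and len: "2 \<le> length p"
    and walk: "walk_in (parcs H) (w # p)" and close: "(last p, w) \<in> parcs H"
  interpret H: pair_graph H
    using assms by (simp add: block_graph_def)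
  let ?U = "set (w # p)"
  have "two_connected (with_proj (induced H ?U))"
  proof (rule H.induced_two_connected[OF sub])
    show "3 \<le> card ?U"
      using dist len distinct_card[OF dist] by simp
    show "connected_on (parcs H) ?U"
      using walk_in_imp_connected_on[OF H.sym_parcs walk] .
    show "connected_on (parcs H) (?U - {v})" if "v \<in> ?U" for v
      using cycle_minus_vertex_connected_on[OF H.sym_parcs dist walk _ close that] len by fastforce
  qed
  then obtain B where B: "H.max_subgraph two_connected B" "subgraph (with_proj (induced H ?U)) B"
    using H.ex_max_subgraph[OF H.subgraph_induced[OF sub], of two_connected] by blast
  then have "arcs_ends B = {(u, v). (u, v) \<in> verts B \<times> verts B \<and> u \<noteq> v}"
    using assms unfolding block_graph_def block_def complete_digraph_def by blast
  moreover have "arcs_ends B \<subseteq> parcs H"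
    using B(1) arcs_ends_mono[of B "with_proj H"] unfolding H.max_subgraph_def by simp
  moreover have "?U \<subseteq> verts B"
    using B(2) unfolding subgraph_def by simp
  ultimately show "\<forall>x \<in> ?U. \<forall>y \<in> ?U. x \<noteq> y \<longrightarrow> (x, y) \<in> parcs H"
    by blast
qed

section \<open>Cliques and separation in \<open>k\<close>-trees\<close>

lemma clique_subset: "clique G C \<Longrightarrow> D \<subseteq> C \<Longrightarrow> clique G D"
  unfolding clique_def by blast

lemma k_tree_imp_pair_graph: "k_tree k G \<Longrightarrow> pair_graph G"
proof (induction rule: k_tree.induct)
  case (complete G)
  then show ?case
    by (simp add: complete_digraph_def pair_graphI_graph)
next
  case (attach G v C)
  interpret pair_graph G by fact
  have C: "C \<subseteq> pverts G"
    using attach.hyps(3) by (simp add: clique_def)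
  show ?case
  proof
    show "symmetric (with_proj (attach_vertex G v C))"
      using sym_parcs unfolding symmetric_def attach_vertex_def by (auto intro!: symI dest: symD)
    show "finite (pverts (attach_vertex G v C))" "finite (parcs (attach_vertex G v C))"
      using attach.hyps finite_verts finite_arcs by (simp_all add: attach_vertex_def)
  qed (use C attach.hyps(2) in \<open>auto simp: attach_vertex_def dest: in_arcsD1 in_arcsD2 no_loops'\<close>)
qed

section \<open>Cliques after attaching a vertex\<close>

context
  fixes G :: "'a pair_pre_digraph" and v :: 'a and C :: "'a set"
  assumes G: "pair_graph G" and v: "v \<notin> pverts G" and C: "clique G C"
begin

lemma not_in_parcs_fresh: "(v, x) \<notin> parcs G" "(x, v) \<notin> parcs G"
proof -
  interpret pair_graph G by (rule G)
  show "(v, x) \<notin> parcs G" "(x, v) \<notin> parcs G"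
    using v in_arcsD1 in_arcsD2 by blast+
qed

lemma fresh_notin_clique: "clique G Q \<Longrightarrow> v \<notin> Q"
  using v unfolding clique_def by blast

lemma clique_attach_vertex_iff:
  "clique (attach_vertex G v C) Q \<longleftrightarrow> (if v \<in> Q then Q \<subseteq> insert v C else clique G Q)"
proof (cases "v \<in> Q")
  case True
  have "x \<in> C" if "clique (attach_vertex G v C) Q" "x \<in> Q" "x \<noteq> v" for x
  proof -
    have "(v, x) \<in> parcs (attach_vertex G v C)"
      using that True by (simp add: clique_def)
    then show ?thesis
      using that not_in_parcs_fresh by (auto simp: attach_vertex_def)
  qed
  moreover have "clique (attach_vertex G v C) (insert v C)"
    using C unfolding clique_def attach_vertex_def by auto
  ultimately show ?thesis
    using True clique_subset[of "attach_vertex G v C" "insert v C" Q] by auto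
next
  case False
  then have "(x, y) \<in> parcs (attach_vertex G v C) \<longleftrightarrow> (x, y) \<in> parcs G" if "x \<in> Q" "y \<in> Q" for x y
    using that by (auto simp: attach_vertex_def)
  moreover from False have "Q \<subseteq> pverts (attach_vertex G v C) \<longleftrightarrow> Q \<subseteq> pverts G"
    by (auto simp: attach_vertex_def)
  ultimately show ?thesis
    using False unfolding clique_def by auto
qed

lemma max_clique_attach_vertex:
  assumes "max_clique (attach_vertex G v C) Q"
  shows "Q = insert v C \<or> max_clique G Q"
proof (cases "v \<in> Q")
  case True
  with assms have "Q \<subseteq> insert v C"
    by (simp add: max_clique_def clique_attach_vertex_iff)
  moreover have "clique (attach_vertex G v C) (insert v C)"
    by (simp add: clique_attach_vertex_iff)
  ultimately show ?thesis
    using assms unfolding max_clique_def by blast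
next
  case False
  have "Q' = Q" if "clique G Q'" "Q \<subseteq> Q'" for Q'
    using that assms fresh_notin_clique[OF that(1)]
    by (simp add: max_clique_def clique_attach_vertex_iff)
  with False assms show ?thesis
    by (simp add: max_clique_def clique_attach_vertex_iff)
qed

text \<open>By \<open>C \<subset> R\<close>, the clique \<open>C\<close> is not maximal in
  \<open>G\<close>, so every old maximal clique survives; a maximal \<open>C\<close> would be
  absorbed by \<open>insert v C\<close>.\<close>

lemma max_clique_attach_vertex_eq:
  assumes "max_clique G R" "C \<subset> R"
  shows "{Q. max_clique (attach_vertex G v C) Q} = insert (insert v C) {Q. max_clique G Q}"
proof -
  have "max_clique (attach_vertex G v C) (insert v C)"
    by (auto simp: max_clique_def clique_attach_vertex_iff split: if_splits)
  moreover have "max_clique (attach_vertex G v C) Q" if Q: "max_clique G Q" for Q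
  proof -
    have vQ: "v \<notin> Q"
      using Q fresh_notin_clique by (simp add: max_clique_def)
    have "Q' = Q" if Q': "clique (attach_vertex G v C) Q'" "Q \<subseteq> Q'" for Q'
    proof (cases "v \<in> Q'")
      case True
      with Q' vQ have "Q \<subseteq> C"
        by (auto simp: clique_attach_vertex_iff)
      with Q assms show ?thesis
        unfolding max_clique_def by blast
    next
      case False
      with Q Q' show ?thesis
        by (simp add: clique_attach_vertex_iff max_clique_def)
    qed
    with Q vQ show ?thesis
      by (simp add: clique_attach_vertex_iff max_clique_def)
  qed
  ultimately show ?thesis
    using max_clique_attach_vertex by blast
qed

end

lemma complete_digraph_max_clique_iff:
  assumes "complete_digraph n (with_proj G)"
  shows "max_clique G Q \<longleftrightarrow> Q = pverts G"
  using assms unfolding complete_digraph_pair_def max_clique_def clique_def by auto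

text \<open>Maximal cliques arise only from the initial complete graph or as
  \<open>insert v C\<close>, where the fresh \<open>v\<close> lies outside \<open>C\<close>.\<close>

lemma k_tree_max_clique_card:
  assumes "k_tree k G" "max_clique G Q"
  shows "finite Q" "card Q = k + 1"
proof -
  have "finite Q \<and> card Q = k + 1"
    using assms
  proof (induction arbitrary: Q rule: k_tree.induct)
    case (complete G)
    then show ?case
      using complete_digraph_max_clique_iff[OF complete.hyps]
      by (simp add: complete_digraph_pair_def)
  next
    case (attach G v C)
    have "v \<notin> C"
      using attach.hyps unfolding clique_def by blast
    moreover have "Q = insert v C \<or> max_clique G Q"
      using max_clique_attach_vertex[OF k_tree_imp_pair_graph[OF attach.hyps(1)]
          attach.hyps(2,3) attach.prems] .
    ultimately show ?case
      using attach.hyps(4,5) attach.IH by auto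
  qed
  then show "finite Q" "card Q = k + 1" by auto
qed

text \<open>
  Path separation phrased by a set that is closed under adjacency outside \<open>Q \<inter> Q'\<close>; unlike the
  condition on paths, it is easily carried over when a vertex is attached.
\<close>

definition separated :: "('a \<times> 'a) set \<Rightarrow> 'a set \<Rightarrow> 'a set \<Rightarrow> bool" where
  "separated E Q Q' \<longleftrightarrow>
     (\<exists>A. Q - Q' \<subseteq> A \<and> A \<inter> Q' = {} \<and> (\<forall>x y. (x, y) \<in> E \<and> x \<in> A \<longrightarrow> y \<in> A \<union> (Q \<inter> Q')))"

text \<open>The witness for the reversed pair is everything outside \<open>A\<close> and
  \<open>Q \<inter> Q'\<close>: an edge from there into \<open>A\<close>, read backwards, would
  leave \<open>A\<close> without entering \<open>Q \<inter> Q'\<close>.\<close>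

lemma separated_commute:
  assumes "sym E" "separated E Q Q'"
  shows "separated E Q' Q"
proof -
  obtain A where A: "Q - Q' \<subseteq> A" "A \<inter> Q' = {}"
    "\<And>x y. (x, y) \<in> E \<Longrightarrow> x \<in> A \<Longrightarrow> y \<in> A \<union> (Q \<inter> Q')"
    using assms(2) unfolding separated_def by blast
  then show ?thesis
    using symD[OF assms(1)] unfolding separated_def
    by (intro exI[of _ "- (A \<union> (Q \<inter> Q'))"]) blast
qed

text \<open>A clique \<open>C\<close> that meets \<open>A\<close> lies in
  \<open>A \<union> (Q \<inter> Q')\<close>, so a vertex attached to \<open>C\<close> cannot link
  the two sides: it joins \<open>A\<close> exactly when \<open>C\<close> meets
  \<open>A\<close>.\<close>

lemma separated_attach_vertex:
  assumes "pair_graph G" "v \<notin> pverts G" "clique G C" "separated (parcs G) Q Q'"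
    and "Q \<subseteq> pverts G" "Q' \<subseteq> pverts G"
  shows "separated (parcs (attach_vertex G v C)) Q Q'"
proof -
  obtain A where A: "Q - Q' \<subseteq> A" "A \<inter> Q' = {}"
    "\<And>x y. (x, y) \<in> parcs G \<Longrightarrow> x \<in> A \<Longrightarrow> y \<in> A \<union> (Q \<inter> Q')"
    using assms(4) unfolding separated_def by blast
  note fresh = not_in_parcs_fresh[OF assms(1-3)]
  have vC: "v \<notin> C" and vQ: "v \<notin> Q" "v \<notin> Q'"
    using assms(2,3,5,6) unfolding clique_def by auto
  \<comment> \<open>\<open>A\<close> is not confined to \<open>pverts G\<close>, so a stray
    \<open>v\<close> is removed first.\<close>
  define A' where "A' = A - {v} \<union> (if C \<inter> A = {} then {} else {v})"
  have C: "C \<subseteq> A \<union> (Q \<inter> Q')" if meets: "C \<inter> A \<noteq> {}"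
  proof
    fix y
    assume "y \<in> C"
    obtain x where "x \<in> C" "x \<in> A"
      using meets by blast
    with \<open>y \<in> C\<close> show "y \<in> A \<union> (Q \<inter> Q')"
      using A(3)[of x y] assms(3) unfolding clique_def by (cases "x = y") auto
  qed
  have "y \<in> A' \<union> (Q \<inter> Q')" if xy: "(x, y) \<in> parcs (attach_vertex G v C)" "x \<in> A'" for x y
  proof -
    consider "(x, y) \<in> parcs G" | "x = v" "y \<in> C" | "x \<in> C" "y = v"
      using xy(1) by (auto simp: attach_vertex_def)
    then show ?thesis
    proof cases
      case 1
      then have "x \<noteq> v" "y \<noteq> v"
        using fresh by blast+
      with xy(2) have "x \<in> A"
        by (auto simp: A'_def split: if_splits)
      with 1 \<open>y \<noteq> v\<close> show ?thesis
        using A(3)[of x y] by (auto simp: A'_def)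
    next
      case 2
      with xy(2) have "C \<inter> A \<noteq> {}"
        by (auto simp: A'_def split: if_splits)
      from C[OF this] 2 vC show ?thesis
        by (auto simp: A'_def)
    next
      case 3
      with xy(2) vC have "C \<inter> A \<noteq> {}"
        by (auto simp: A'_def split: if_splits)
      with 3 show ?thesis
        by (auto simp: A'_def)
    qed
  qed
  moreover have "Q - Q' \<subseteq> A'" "A' \<inter> Q' = {}"
    using A(1,2) vQ by (auto simp: A'_def)
  ultimately show ?thesis
    unfolding separated_def by blast
qed

text \<open>Separation of old cliques survives attaching a vertex. The new clique
  \<open>insert v C\<close> is separated from an old one by \<open>C\<close>, because all neighbours
  of \<open>v\<close> lie in \<open>C\<close>.\<close>

lemma k_tree_max_cliques_separated:
  assumes "k_tree k G" "max_clique G Q" "max_clique G Q'" "card (Q \<inter> Q') = k"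
  shows "separated (parcs G) Q Q'"
  using assms
proof (induction arbitrary: Q Q' rule: k_tree.induct)
  case (complete G)
  then show ?case
    using complete_digraph_max_clique_iff[OF complete.hyps]
    by (simp add: complete_digraph_pair_def)
next
  case (attach G v C)
  have pg: "pair_graph G"
    using attach.hyps(1) by (rule k_tree_imp_pair_graph)
  interpret G': pair_graph "attach_vertex G v C"
    using attach.hyps by (intro k_tree_imp_pair_graph k_tree.attach)
  note max = max_clique_attach_vertex[OF pg attach.hyps(2,3)]
  note fresh = not_in_parcs_fresh[OF pg attach.hyps(2,3)]
  have vC: "v \<notin> C"
    using attach.hyps(2,3) unfolding clique_def by auto
  have old_verts: "R \<subseteq> pverts G" if "max_clique G R" for R
    using that unfolding max_clique_def clique_def by blast
  have new: "separated (parcs (attach_vertex G v C)) (insert v C) R"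
    if "max_clique G R" "card (insert v C \<inter> R) = k" for R
  proof -
    have vR: "v \<notin> R"
      using old_verts[OF that(1)] attach.hyps(2) by auto
    \<comment> \<open>As \<open>v\<close> is not in \<open>R\<close>, the \<open>k\<close> common
      elements all lie in \<open>C\<close>, which has only \<open>k\<close>.\<close>
    then have "insert v C \<inter> R = C"
      using that(2) attach.hyps(4,5) card_subset_eq[of C "C \<inter> R"] by auto
    with vR vC fresh show ?thesis
      unfolding separated_def
      by (intro exI[of _ "{v}"]) (auto simp: attach_vertex_def)
  qed
  consider "max_clique G Q" "max_clique G Q'" | "Q = insert v C" "Q' = insert v C"
    | "Q = insert v C" "max_clique G Q'" | "max_clique G Q" "Q' = insert v C"
    using max attach.prems(1,2) by blast
  then show ?case
  proof cases
    case 1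
    then show ?thesis
      using attach separated_attach_vertex[OF pg attach.hyps(2,3)] old_verts by blast
  next
    \<comment> \<open>Equal cliques share \<open>k + 1\<close> elements, against the
      assumption.\<close>
    case 2
    then show ?thesis
      using attach.prems(3) attach.hyps(4,5) vC by simp
  next
    case 3
    then show ?thesis
      using new attach.prems(3) by blast
  next
    case 4
    then show ?thesis
      using new[of Q] attach.prems(3) separated_commute[OF G'.sym_parcs] by (simp add: Int_commute)
  qed
qed

text \<open>An attached vertex has \<open>k\<close> old neighbours, so at least one survives the
  removal of \<open>I\<close> and keeps it connected to the rest.\<close>

lemma k_tree_minus_few_vertices_connected_on:
  assumes "k_tree k G" "finite I" "card I < k"
  shows "connected_on (parcs G) (pverts G - I)"
  using assms(1)
proof (induction rule: k_tree.induct)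
  case (complete G)
  then have "parcs G = {(u, v). (u, v) \<in> pverts G \<times> pverts G \<and> u \<noteq> v}"
    by (simp add: complete_digraph_pair_def)
  then have "(x, y) \<in> rtrancl_on (pverts G - I) (parcs G)"
    if "x \<in> pverts G - I" "y \<in> pverts G - I" for x y
    using that by (cases "x = y") (auto intro: rtrancl_on_into_rtrancl_on[of x x])
  then show ?case
    unfolding connected_on_def by blast
next
  case (attach G v C)
  interpret G': pair_graph "attach_vertex G v C"
    using attach.hyps by (intro k_tree_imp_pair_graph k_tree.attach)
  have "connected_on (parcs (attach_vertex G v C)) (pverts G - I)"
    using attach.IH by (rule connected_on_mono) (auto simp: attach_vertex_def)
  moreover obtain c where "c \<in> C - I"
    using attach.hyps(4,5) assms(2,3) card_mono[of I C] by fastforce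
  moreover from this have "c \<in> pverts G - I" "(c, v) \<in> parcs (attach_vertex G v C)"
    using attach.hyps(3) by (auto simp: clique_def attach_vertex_def)
  ultimately show ?case
    using connected_on_insert[OF _ G'.sym_parcs, of "pverts G - I" c v] attach.hyps(2)
    by (cases "v \<in> I") (auto simp: attach_vertex_def insert_Diff_if)
qed

text \<open>Translates the arc lists inside \<open>vwalk\<close> and \<open>vpath\<close> into
  \<open>walk_in\<close>.\<close>

lemma set_vwalk_arcs_subset_iff: "set (vwalk_arcs p) \<subseteq> E \<longleftrightarrow> walk_in E p"
  by (induction p rule: vwalk_arcs.induct) auto

text \<open>A walk that starts in \<open>A\<close> and avoids \<open>Q \<inter> Q'\<close> never
  leaves \<open>A\<close>, yet \<open>A\<close> is disjoint from \<open>Q'\<close>.\<close>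

lemma separated_imp_path_meets:
  assumes "separated E Q Q'" "walk_in E p" "p \<noteq> []" "hd p \<in> Q - Q'" "last p \<in> Q' - Q"
  shows "set p \<inter> (Q \<inter> Q') \<noteq> {}"
proof
  assume disj: "set p \<inter> (Q \<inter> Q') = {}"
  obtain A where A: "Q - Q' \<subseteq> A" "A \<inter> Q' = {}"
    "\<And>x y. (x, y) \<in> E \<Longrightarrow> x \<in> A \<Longrightarrow> y \<in> A \<union> (Q \<inter> Q')"
    using assms(1) unfolding separated_def by blast
  have "last p \<in> A"
    using assms(2,3) disj \<open>hd p \<in> Q - Q'\<close>[THEN subsetD[OF A(1)]]
  proof (induction p rule: induct_list012)
    case (3 x y zs)
    then show ?case
      using A(3)[of x y] by auto
  qed auto
  with A(2) assms(5) show False by blast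
qed

text \<open>For \<open>k\<close> common elements, \<open>separated\<close> yields the path condition
  and \<open>1 \<le> k\<close> a nonempty intersection. Conversely, removing fewer than
  \<open>k\<close> vertices leaves a path from \<open>Q - Q'\<close> to \<open>Q' - Q\<close>
  avoiding them.\<close>

theorem k_tree_separating_pair_iff:
  assumes "k_tree k G" "1 \<le> k" "max_clique G Q" "max_clique G Q'" "Q \<noteq> Q'"
  shows "separating_pair G Q Q' \<longleftrightarrow> card (Q \<inter> Q') = k"
proof
  assume card: "card (Q \<inter> Q') = k"
  then have "Q \<inter> Q' \<noteq> {}"
    using assms(2) by auto
  moreover have "separated (parcs G) Q Q'"
    using assms card k_tree_max_cliques_separated by blast
  ultimately show "separating_pair G Q Q'"
    using separated_imp_path_meets
    unfolding separating_pair_def vpath_def vwalk_def with_proj_simps set_vwalk_arcs_subset_iff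
    by blast
next
  assume sep: "separating_pair G Q Q'"
  have fin: "finite Q" and "card Q = k + 1"
    using assms k_tree_max_clique_card by blast+
  \<comment> \<open>Incomparability provides the end points of that path and bounds the intersection
    by \<open>k\<close>.\<close>
  have "\<not> Q \<subseteq> Q'" "\<not> Q' \<subseteq> Q"
    using assms(3-5) unfolding max_clique_def by blast+
  then obtain x y where xy: "x \<in> Q - Q'" "y \<in> Q' - Q" by blast
  then have "card (Q \<inter> Q') < card Q"
    using fin by (intro psubset_card_mono) auto
  then have le: "card (Q \<inter> Q') \<le> k"
    using \<open>card Q = k + 1\<close> by simp
  show "card (Q \<inter> Q') = k"
  proof (rule ccontr)
    assume "card (Q \<inter> Q') \<noteq> k"
    with le fin have "connected_on (parcs G) (pverts G - Q \<inter> Q')"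
      using k_tree_minus_few_vertices_connected_on[OF assms(1), of "Q \<inter> Q'"] by simp
    moreover have "x \<in> pverts G - Q \<inter> Q'" "y \<in> pverts G - Q \<inter> Q'"
      using xy assms(3,4) unfolding max_clique_def clique_def by auto
    ultimately have "(x, y) \<in> rtrancl_on (pverts G - Q \<inter> Q') (parcs G)"
      unfolding connected_on_def by blast
    then obtain p where p: "p \<noteq> []" "distinct p" "set p \<subseteq> pverts G - Q \<inter> Q'"
      "walk_in (parcs G) p" "hd p = x" "last p = y"
      by (blast dest: rtrancl_on_imp_path)
    then have "vpath p (with_proj G)"
      unfolding vpath_def vwalk_def with_proj_simps set_vwalk_arcs_subset_iff by blast
    with sep p xy show False
      unfolding separating_pair_def by blast
  qed
qed

section \<open>The construction\<close>

text \<open>Since \<open>w\<close> is not a cut vertex, some path from \<open>a\<close> to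
  \<open>b\<close> avoids it; closed through \<open>w\<close>, it becomes a cycle containing
  both.\<close>

lemma path_closes_to_clique:
  assumes "sym E" "cycles_complete E V" "w \<in> V" "connected_on E (V - {w})"
    and "a \<in> V - {w}" "b \<in> V - {w}" "a \<noteq> b" "(w, a) \<in> E" "(w, b) \<in> E"
  shows "(a, b) \<in> E"
proof -
  have "(a, b) \<in> rtrancl_on (V - {w}) E"
    using assms(4-6) unfolding connected_on_def by blast
  then obtain p where p: "p \<noteq> []" "distinct p" "set p \<subseteq> V - {w}" "walk_in E p"
    "hd p = a" "last p = b"
    by (blast dest: rtrancl_on_imp_path)
  have "2 \<le> length p"
    using p assms(7) by (cases p rule: vwalk_arcs.cases) auto
  moreover have "(last p, w) \<in> E"
    using p(6) assms(1,9) by (auto dest: symD)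
  moreover have "walk_in E (w # p)"
    using p assms(8) by (simp add: successively_Cons)
  moreover have "distinct (w # p)" "set (w # p) \<subseteq> V"
    using p assms(3) by auto
  ultimately have "\<forall>x \<in> set (w # p). \<forall>y \<in> set (w # p). x \<noteq> y \<longrightarrow> (x, y) \<in> E"
    using assms(2) unfolding cycles_complete_def by blast
  moreover have "a \<in> set (w # p)" "b \<in> set (w # p)"
    using p by auto
  ultimately show ?thesis
    using assms(7) by blast
qed

text \<open>Serves to show that a vertex adjacent to two neighbours of \<open>w\<close> is itself a
  neighbour of \<open>w\<close>.\<close>

lemma four_cycle_chord:
  assumes "cycles_complete E V" "distinct [w, a, x, b]" "{w, a, x, b} \<subseteq> V"
    and "(w, a) \<in> E" "(a, x) \<in> E" "(x, b) \<in> E" "(b, w) \<in> E"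
  shows "(w, x) \<in> E"
proof -
  have "\<forall>u \<in> set (w # [a, x, b]). \<forall>v \<in> set (w # [a, x, b]). u \<noteq> v \<longrightarrow> (u, v) \<in> E"
    using assms(1)[unfolded cycles_complete_def, rule_format, of w "[a, x, b]"] assms(2-) by auto
  then show ?thesis
    using assms(2) by auto
qed

section \<open>Subsets of size k in sets of size k + 1\<close>

lemma card_k_subset_of_Suc:
  assumes "finite Q" "card Q = k + 1" "S \<subseteq> Q" "card S = k"
  obtains x where "x \<in> Q" "S = Q - {x}"
proof -
  have "card (Q - S) = 1"
    using assms by (simp add: card_Diff_subset finite_subset)
  then obtain x where "Q - S = {x}"
    using card_1_singletonE by blast
  with assms(3) have "x \<in> Q" "S = Q - {x}" by auto
  then show ?thesis by (rule that)
qed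

text \<open>The \<open>k + 1\<close> distinct sets \<open>Q - {x}\<close> are too many to all lie in
  \<open>F\<close>.\<close>

lemma ex_avoiding_subset:
  assumes "finite Q" "card Q = k + 1" "finite F" "card F \<le> k"
  shows "\<exists>S. S \<subset> Q \<and> card S = k \<and> S \<notin> F"
proof -
  have "inj_on (\<lambda>x. Q - {x}) Q"
    by (auto intro!: inj_onI)
  then have "card ((\<lambda>x. Q - {x}) ` Q) = k + 1"
    using assms(2) by (simp add: card_image)
  then have "\<not> (\<lambda>x. Q - {x}) ` Q \<subseteq> F"
    using assms(3,4) card_mono[of F "(\<lambda>x. Q - {x}) ` Q"] by auto
  then obtain x where "x \<in> Q" "Q - {x} \<notin> F" by blast
  then show ?thesis
    using assms(1,2) by (intro exI[of _ "Q - {x}"]) auto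
qed

text \<open>
  Three \<open>(k + 1)\<close>-sets that meet pairwise in \<open>k\<close> elements share these elements or lie in a common
  \<open>(k + 2)\<close>-set; maximality of the cliques excludes the second alternative.
\<close>

lemma max_cliques_triangle:
  assumes "k_tree k G" "max_clique G Q1" "max_clique G Q2" "max_clique G Q3"
    and "card (Q1 \<inter> Q2) = k" "card (Q1 \<inter> Q3) = k" "card (Q2 \<inter> Q3) = k"
  shows "Q1 \<inter> Q2 \<subseteq> Q3"
proof (rule ccontr)
  assume "\<not> Q1 \<inter> Q2 \<subseteq> Q3"
  then obtain s where s: "s \<in> Q1" "s \<in> Q2" "s \<notin> Q3" by blast
  note fin = k_tree_max_clique_card[OF assms(1)]
  obtain x where x: "x \<in> Q1" "Q1 \<inter> Q3 = Q1 - {x}"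
    using card_k_subset_of_Suc[OF fin[OF assms(2)] Int_lower1 assms(6)] by blast
  obtain y where y: "y \<in> Q2" "Q2 \<inter> Q3 = Q2 - {y}"
    using card_k_subset_of_Suc[OF fin[OF assms(3)] Int_lower1 assms(7)] by blast
  \<comment> \<open>\<open>Q1\<close> and \<open>Q2\<close> each have just one element outside
    \<open>Q3\<close>, and \<open>s\<close> is such an element of both.\<close>
  have "x = s" "y = s"
    using s x y by blast+
  then have sub: "Q1 - {s} \<subseteq> Q3" "Q2 - {s} \<subseteq> Q3"
    using x y by blast+
  have "clique G (Q1 \<union> Q2)"
    unfolding clique_def
  proof (intro conjI ballI impI)
    show "Q1 \<union> Q2 \<subseteq> pverts G"
      using assms(2,3) unfolding max_clique_def clique_def by blast
    fix u v
    assume "u \<in> Q1 \<union> Q2" "v \<in> Q1 \<union> Q2" "u \<noteq> v"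
    \<comment> \<open>All elements except \<open>s\<close> lie in \<open>Q3\<close>, and
      \<open>s\<close> lies in both \<open>Q1\<close> and \<open>Q2\<close>.\<close>
    then have "u \<in> Q1 \<and> v \<in> Q1 \<or> u \<in> Q2 \<and> v \<in> Q2 \<or> u \<in> Q3 \<and> v \<in> Q3"
      using sub s by blast
    with \<open>u \<noteq> v\<close> show "(u, v) \<in> parcs G"
      using assms(2-4) by (auto simp: max_clique_def clique_def)
  qed
  then have "Q1 \<union> Q2 = Q1" "Q1 \<union> Q2 = Q2"
    using assms(2,3) unfolding max_clique_def by blast+
  then have "Q1 \<inter> Q2 = Q1" by blast
  with assms(5) fin(2)[OF assms(2)] show False by simp
qed

text \<open>Intersections of size \<open>k\<close> are easier to maintain than
  \<open>separating_pair\<close>; \<open>k_tree_separating_pair_iff\<close> translates them at the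
  end. Keeping \<open>V\<close> apart from \<open>E\<close> lets the induction shrink the vertex set
  alone.\<close>

definition represents :: "nat \<Rightarrow> 'b pair_pre_digraph \<Rightarrow> ('a \<Rightarrow> 'b set) \<Rightarrow> ('a \<times> 'a) set \<Rightarrow> 'a set \<Rightarrow> bool"
where
  "represents k G Q E V \<longleftrightarrow> k_tree k G \<and> bij_betw Q V {C. max_clique G C} \<and>
     (\<forall>u \<in> V. \<forall>v \<in> V. u \<noteq> v \<longrightarrow> ((u, v) \<in> E \<longleftrightarrow> card (Q u \<inter> Q v) = k))"

text \<open>As \<open>z\<close> is fresh, the new clique meets \<open>Q u\<close> in
  \<open>S \<inter> Q u\<close>, which has \<open>k\<close> elements iff
  \<open>S \<subseteq> Q u\<close>. Since \<open>S\<close> is a proper subset of \<open>Q v\<close>,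
  all old maximal cliques survive.\<close>

lemma represents_attach_vertex:
  assumes "represents k G Q E V" "sym E" "w \<notin> V"
    and "v \<in> V" "S \<subset> Q v" "card S = k" "{u \<in> V. S \<subseteq> Q u} = {u \<in> V. (w, u) \<in> E}"
    and "z \<notin> pverts G"
  shows "represents k (attach_vertex G z S) (Q(w := insert z S)) E (insert w V)"
proof -
  have G: "k_tree k G" and bij: "bij_betw Q V {C. max_clique G C}"
    and adj: "\<And>u v. u \<in> V \<Longrightarrow> v \<in> V \<Longrightarrow> u \<noteq> v \<Longrightarrow> (u, v) \<in> E \<longleftrightarrow> card (Q u \<inter> Q v) = k"
    using assms(1) unfolding represents_def by blast+
  have max: "max_clique G (Q u)" if "u \<in> V" for u
    using bij that unfolding bij_betw_def by blast
  have S: "clique G S" "finite S"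
    using max[OF assms(4)] assms(5) clique_subset k_tree_max_clique_card(1)[OF G max[OF assms(4)]]
      finite_subset unfolding max_clique_def by blast+
  have z: "z \<notin> Q u" if "u \<in> V" for u
    using max[OF that] assms(8) unfolding max_clique_def clique_def by blast
  have "bij_betw (Q(w := insert z S)) V {C. max_clique G C}"
    using bij assms(3) by (subst bij_betw_cong[of _ _ Q]) auto
  moreover have "insert z S \<notin> {C. max_clique G C}"
    using assms(8) unfolding max_clique_def clique_def by blast
  ultimately have "bij_betw (Q(w := insert z S)) (insert w V) (insert (insert z S) {C. max_clique G C})"
    using assms(3) bij_betw_combine[of "Q(w := insert z S)" V "{C. max_clique G C}" "{w}" "{insert z S}"]
    by (simp add: bij_betw_def)
  then have bij': "bij_betw (Q(w := insert z S)) (insert w V) {C. max_clique (attach_vertex G z S) C}"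
    using max_clique_attach_vertex_eq[OF k_tree_imp_pair_graph[OF G] assms(8) S(1) max[OF assms(4)] assms(5)]
    by simp
  have new: "(w, u) \<in> E \<longleftrightarrow> card (insert z S \<inter> Q u) = k" if "u \<in> V" for u
  proof -
    have "insert z S \<inter> Q u = S \<inter> Q u"
      using z[OF that] by blast
    moreover have "card (S \<inter> Q u) = k \<longleftrightarrow> S \<subseteq> Q u"
      using card_subset_eq[OF S(2), of "S \<inter> Q u"] assms(6) by (auto simp: Int_absorb2)
    ultimately show ?thesis
      using assms(7) that by auto
  qed
  have "(u, u') \<in> E \<longleftrightarrow> card ((Q(w := insert z S)) u \<inter> (Q(w := insert z S)) u') = k"
    if "u \<in> insert w V" "u' \<in> insert w V" "u \<noteq> u'" for u u'
    using that adj[of u u'] new[of u] new[of u'] assms(3) symD[OF assms(2), of u w] symD[OF assms(2), of w u]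
    by (auto simp: Int_commute)
  moreover have "k_tree k (attach_vertex G z S)"
    using G S assms(6,8) by (intro k_tree.attach)
  ultimately show ?thesis
    using bij' unfolding represents_def by blast
qed

lemma represents_singleton:
  "\<exists>(G :: nat pair_pre_digraph) Q. represents k G Q E {u}"
proof -
  let ?V = "{..k}"
  let ?G = "\<lparr> pverts = ?V, parcs = {(u, v). (u, v) \<in> ?V \<times> ?V \<and> u \<noteq> v} \<rparr>"
  have K: "complete_digraph (k + 1) (with_proj ?G)"
    unfolding complete_digraph_pair_def by simp
  then have "k_tree k ?G"
    by (rule k_tree.complete)
  moreover have "bij_betw (\<lambda>_. ?V) {u} {C. max_clique ?G C}"
    using complete_digraph_max_clique_iff[OF K] by (simp add: bij_betw_def)
  ultimately show ?thesis
    unfolding represents_def by blast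
qed

lemma ex_separator_for_neighbourhood:
  assumes rep: "represents k G Q E (V - {w})"
    and "sym E" "finite V" "cycles_complete E V" "connected_on E (V - {w})" "w \<in> V" "card V \<le> k"
    and "a \<in> V - {w}" "(w, a) \<in> E"
  shows "\<exists>S. S \<subset> Q a \<and> card S = k \<and> {u \<in> V - {w}. S \<subseteq> Q u} = {u \<in> V - {w}. (w, u) \<in> E}"
proof -
  let ?U = "V - {w}"
  have G: "k_tree k G" and inj: "inj_on Q ?U"
    and adj: "\<And>u v. u \<in> ?U \<Longrightarrow> v \<in> ?U \<Longrightarrow> u \<noteq> v \<Longrightarrow> (u, v) \<in> E \<longleftrightarrow> card (Q u \<inter> Q v) = k"
    and max: "\<And>u. u \<in> ?U \<Longrightarrow> max_clique G (Q u)"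
    using rep unfolding represents_def bij_betw_def by blast+
  note card = k_tree_max_clique_card[OF G max]
  \<comment> \<open>An intersection of \<open>k + 1\<close> elements would put one maximal clique
    inside another.\<close>
  have sub_imp_card: "card (Q u \<inter> Q v) = k"
    if uv: "u \<in> ?U" "v \<in> ?U" "u \<noteq> v" "S \<subseteq> Q u" "S \<subseteq> Q v" "card S = k" for u v S
  proof -
    have "\<not> Q u \<subseteq> Q v"
      using max[OF uv(1)] max[OF uv(2)] inj_onD[OF inj _ uv(1,2)] uv(3) unfolding max_clique_def by blast
    then have "card (Q u \<inter> Q v) < card (Q u)"
      using card(1)[OF uv(1)] by (intro psubset_card_mono) auto
    moreover have "k \<le> card (Q u \<inter> Q v)"
      using uv(4-6) card(1)[OF uv(1)] card_mono[of "Q u \<inter> Q v" S] by auto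
    ultimately show ?thesis
      using card(2)[OF uv(1)] by simp
  qed
  show ?thesis
  proof (cases "\<exists>b \<in> ?U. b \<noteq> a \<and> (w, b) \<in> E")
    case True
    then obtain b where b: "b \<in> ?U" "b \<noteq> a" "(w, b) \<in> E" by blast
    have nbrs: "(u, v) \<in> E" if "u \<in> ?U" "v \<in> ?U" "u \<noteq> v" "(w, u) \<in> E" "(w, v) \<in> E" for u v
      using path_closes_to_clique[OF assms(2,4,6,5)] that by blast
    let ?S = "Q a \<inter> Q b"
    have S: "card ?S = k"
      using adj[of a b] nbrs[of a b] b assms(8,9) by blast
    moreover have "?S \<subset> Q a"
      using S card(2)[OF assms(8)] by (metis Int_lower1 Suc_eq_plus1 n_not_Suc_n psubsetI)
    \<comment> \<open>Sharing \<open>?S\<close> with \<open>a\<close> and \<open>b\<close> makes any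
      other \<open>u\<close> adjacent to both, and the cycle \<open>w\<close>, \<open>a\<close>,
      \<open>u\<close>, \<open>b\<close> then has the chord from \<open>w\<close> to
      \<open>u\<close>.\<close>
    moreover have "(w, u) \<in> E" if u: "u \<in> ?U" "?S \<subseteq> Q u" for u
    proof (cases "u = a \<or> u = b")
      case True
      then show ?thesis
        using assms(9) b(3) by blast
    next
      case False
      then have "(a, u) \<in> E" "(u, b) \<in> E"
        using sub_imp_card[of a u ?S] sub_imp_card[of u b ?S] adj u b(1) assms(8) S by auto
      then show ?thesis
        using four_cycle_chord[OF assms(4), of w a u b] False u(1) b assms(6,8,9)
          symD[OF assms(2) b(3)] by auto
    qed
    \<comment> \<open>Neighbours of \<open>w\<close> are pairwise adjacent, so the cliques of
      \<open>a\<close>, \<open>b\<close> and a third neighbour \<open>u\<close> meet pairwise in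
      \<open>k\<close> elements.\<close>
    moreover have "?S \<subseteq> Q u" if u: "u \<in> ?U" "(w, u) \<in> E" for u
    proof (cases "u = a \<or> u = b")
      case True
      then show ?thesis by blast
    next
      case False
      then have "card (Q a \<inter> Q u) = k" "card (Q b \<inter> Q u) = k"
        using nbrs[of a u] nbrs[of b u] adj[of a u] adj[of b u] u b assms(8,9) by auto
      then show ?thesis
        using max_cliques_triangle[OF G] max assms(8) b(1) u(1) S by blast
    qed
    ultimately show ?thesis by blast
  next
    case False
    \<comment> \<open>Here \<open>a\<close> is the only neighbour of \<open>w\<close>. Any other
      \<open>u\<close> with \<open>S \<subseteq> Q u\<close> would force
      \<open>S = Q a \<inter> Q u\<close>, so these sets are the ones to avoid.\<close>
    let ?F = "(\<lambda>u. Q a \<inter> Q u) ` (?U - {a})"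
    have "card ?F \<le> card V"
      using assms(3) by (meson card_image_le card_mono Diff_subset finite_Diff order_trans)
    then obtain S where S: "S \<subset> Q a" "card S = k" "S \<notin> ?F"
      using ex_avoiding_subset[OF card[OF assms(8)], of ?F] assms(3,7) by auto
    have only_a: "u = a" if u: "u \<in> ?U" "S \<subseteq> Q u" for u
    proof (rule ccontr)
      assume "u \<noteq> a"
      have "card (Q a \<inter> Q u) = k"
        using sub_imp_card[of a u S] u S \<open>u \<noteq> a\<close> assms(8) by blast
      then have "S = Q a \<inter> Q u"
        using S u(2) card(1)[OF assms(8)] card_subset_eq[of "Q a \<inter> Q u" S] by auto
      with S(3) u(1) \<open>u \<noteq> a\<close> show False by blast
    qed
    have "u \<in> ?U \<and> S \<subseteq> Q u \<longleftrightarrow> u \<in> ?U \<and> (w, u) \<in> E" for u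
      using only_a[of u] False S(1) assms(8,9) by (cases "u = a") auto
    then have "{u \<in> ?U. S \<subseteq> Q u} = {u \<in> ?U. (w, u) \<in> E}"
      by blast
    with S show ?thesis by blast
  qed
qed

text \<open>Removing a non-cut vertex preserves connectedness and the cycle condition, while
  \<open>k\<close> is fixed in advance and \<open>card V \<le> k\<close> persists.\<close>

lemma ex_represents:
  assumes "sym E" "finite V" "V \<noteq> {}" "cycles_complete E V" "connected_on E V" "card V \<le> k"
  shows "\<exists>(G :: nat pair_pre_digraph) Q. represents k G Q E V"
  using assms(2-)
proof (induction "card V" arbitrary: V rule: less_induct)
  case less
  show ?case
  proof (cases "card V = 1")
    case True
    then show ?thesis
      using represents_singleton by (metis card_1_singletonE)
  next
    case False
    with less.prems have "2 \<le> card V"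
      by (metis One_nat_def Suc_1 card_gt_0_iff le_neq_implies_less less_eq_Suc_le)
    then obtain w where w: "w \<in> V" "connected_on E (V - {w})"
      using ex_noncut_vertex assms(1) less.prems by blast
    have "card (V - {w}) < card V" "V - {w} \<noteq> {}"
      using w(1) less.prems(1) \<open>2 \<le> card V\<close> card_Diff1_less card_mono[of "{w}" V] by auto
    then obtain G :: "nat pair_pre_digraph" and Q where rep: "represents k G Q E (V - {w})"
      using less.hyps[of "V - {w}"] less.prems w(2) cycles_complete_subset[of E V "V - {w}"] by auto
    obtain a where a: "a \<in> V - {w}" "(w, a) \<in> E"
      using connected_on_leaves[OF less.prems(4), of "{w}"] w(1) \<open>V - {w} \<noteq> {}\<close> by blast
    obtain S where S: "S \<subset> Q a" "card S = k"
      "{u \<in> V - {w}. S \<subseteq> Q u} = {u \<in> V - {w}. (w, u) \<in> E}"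
      using ex_separator_for_neighbourhood[OF rep assms(1) less.prems(1,3) w(2,1) less.prems(5) a] by blast
    have "pair_graph G"
      using rep k_tree_imp_pair_graph unfolding represents_def by blast
    then interpret pair_graph G .
    \<comment> \<open>The finite \<open>pverts G\<close> cannot exhaust the natural numbers.\<close>
    obtain z where "z \<notin> pverts G"
      using ex_new_if_finite[OF _ finite_verts] by auto
    then have "represents k (attach_vertex G z S) (Q(w := insert z S)) E (insert w (V - {w}))"
      using represents_attach_vertex[OF rep assms(1) _ a(1) S] by simp
    then show ?thesis
      using w(1) by (metis insert_Diff)
  qed
qed

text \<open>The inverse of \<open>Q\<close>, applied componentwise to arcs, is the
  isomorphism.\<close>

lemma represents_imp_reduced_clique_graph_iso:
  assumes "represents k G Q (parcs H) (pverts H)" "1 \<le> k" "pair_graph H"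
  shows "digraph_iso (with_proj (reduced_clique_graph G)) (with_proj H)"
proof -
  interpret H: pair_graph H by fact
  let ?R = "reduced_clique_graph G"
  let ?f = "the_inv_into (pverts H) Q"
  have G: "k_tree k G" and inj: "inj_on Q (pverts H)" and im: "Q ` pverts H = pverts ?R"
    and adj: "\<And>u v. u \<in> pverts H \<Longrightarrow> v \<in> pverts H \<Longrightarrow> u \<noteq> v \<Longrightarrow>
      (u, v) \<in> parcs H \<longleftrightarrow> card (Q u \<inter> Q v) = k"
    using assms(1) unfolding represents_def bij_betw_def reduced_clique_graph_def by auto
  have arcs: "parcs ?R = map_prod Q Q ` parcs H"
  proof -
    have "(Q u, Q v) \<in> parcs ?R \<longleftrightarrow> (u, v) \<in> parcs H" if uv: "u \<in> pverts H" "v \<in> pverts H" for u v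
    proof (cases "u = v")
      case True
      then show ?thesis
        using H.no_loops' by (auto simp: reduced_clique_graph_def)
    next
      case False
      have "max_clique G (Q u)" "max_clique G (Q v)"
        using im uv by (auto simp: reduced_clique_graph_def)
      moreover have "Q u \<noteq> Q v"
        using False inj uv by (auto dest: inj_onD)
      ultimately show ?thesis
        using k_tree_separating_pair_iff[OF G assms(2)] adj[OF uv False]
        by (simp add: reduced_clique_graph_def)
    qed
    note iff = this
    have "parcs ?R \<subseteq> pverts ?R \<times> pverts ?R"
      by (auto simp: reduced_clique_graph_def)
    show ?thesis
    proof
      show "parcs ?R \<subseteq> map_prod Q Q ` parcs H"
      proof
        fix e
        assume e: "e \<in> parcs ?R"
        then have "e \<in> Q ` pverts H \<times> Q ` pverts H"
          using \<open>parcs ?R \<subseteq> pverts ?R \<times> pverts ?R\<close> im by blast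
        then obtain u v where "u \<in> pverts H" "v \<in> pverts H" "e = (Q u, Q v)" by blast
        with e iff show "e \<in> map_prod Q Q ` parcs H" by force
      qed
      show "map_prod Q Q ` parcs H \<subseteq> parcs ?R"
        using iff H.in_arcsD1 H.in_arcsD2 by auto
    qed
  qed
  have inv: "?f (Q u) = u" if "u \<in> pverts H" for u
    using inj that by (rule the_inv_into_f_f)
  have inj_f: "inj_on ?f (pverts ?R)"
    using inj_on_the_inv_into[OF inj] im by simp
  have sub: "parcs ?R \<subseteq> pverts ?R \<times> pverts ?R"
    by (auto simp: reduced_clique_graph_def)
  have "inj_on (map_prod ?f ?f) (parcs ?R)"
    using map_prod_inj_on[OF inj_f inj_f] sub by (rule inj_on_subset)
  moreover have "?f ` pverts ?R = pverts H"
    using inv unfolding im[symmetric] by force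
  moreover have "map_prod ?f ?f ` parcs ?R = parcs H"
  proof -
    have "map_prod ?f ?f (map_prod Q Q e) = e" if "e \<in> parcs H" for e
      using that inv H.in_arcsD1 H.in_arcsD2 by (cases e) auto
    then show ?thesis
      unfolding arcs by force
  qed
  moreover have "wf_digraph (with_proj ?R)"
    by unfold_locales (auto simp: reduced_clique_graph_def)
  ultimately show ?thesis
    using inj_f sub
    unfolding digraph_iso_def pre_digraph.digraph_isomorphism_def app_iso_def
    \<comment> \<open>\<open>iso_head\<close> and \<open>iso_tail\<close> are the head and tail maps
      of the target graph, whose arcs are pairs.\<close>
    by (intro exI[of _ "\<lparr> iso_verts = ?f, iso_arcs = map_prod ?f ?f, iso_head = snd, iso_tail = fst \<rparr>"])
      (simp add: with_proj_def)
qed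

theorem theorem12:
  fixes H :: "'a pair_pre_digraph"
  assumes "block_graph H"
    and "Digraph_Component.connected (with_proj H)"
  shows "\<exists>k \<ge> (1::nat). \<exists>G :: nat pair_pre_digraph.
    k_tree k G \<and> digraph_iso (with_proj (reduced_clique_graph G)) (with_proj H)"
proof -
  interpret H: pair_graph H
    using assms(1) by (simp add: block_graph_def)
  \<comment> \<open>Large enough for every step: a new vertex with a single neighbour has fewer than
    \<open>card (pverts H)\<close> subsets to avoid.\<close>
  let ?k = "card (pverts H)"
  have conn: "pverts H \<noteq> {}" "connected_on (parcs H) (pverts H)"
    using assms(2) unfolding H.connected_iff_connected_on by blast+
  then have "1 \<le> ?k"
    using H.finite_verts by (simp add: Suc_le_eq card_gt_0_iff)
  moreover obtain G :: "nat pair_pre_digraph" and Q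
    where "represents ?k G Q (parcs H) (pverts H)"
    using ex_represents[OF H.sym_parcs H.finite_verts conn(1)
        block_graph_imp_cycles_complete[OF assms(1)] conn(2) order_refl] by blast
  ultimately show ?thesis
    using represents_imp_reduced_clique_graph_iso H.pair_graph unfolding represents_def by blast
qed

end
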